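(* Let $\mathcal{G}$ be the modified product stochastic game with accepting set $\mathcal{E}$ and dummy state $dest$, and let $v^0,v^1,v^2,\dots$ be the iterates of the value iteration algorithm with tolerance $\delta$ described in the context. There exists a vector $v^{\infty}$ such that for any $\epsilon>0$ there exist $\delta>0$ and $K$ such that, with tolerance $\delta$, $\|v^k-v^\infty\|_\infty<\epsilon$ for all $k>K$. Furthermore, $v^\infty$ satisfies, for every state $s$ of $\mathcal{G}$, $$v^\infty(s)=\max_{\mu}\min_{\tau}\sum_{u_C\in U_C(s)}\ \sum_{u_A\in U_A(s)}\ \sum_{s'}\mu(s,u_C)\,\tau(s,u_A)\,v^\infty(s')\,Pr_\mathcal{G}(s,u_C,u_A,s').$$
   Context: $\mathcal{G}$ is a finite two-player concurrent stochastic game: finite state set $S_\mathcal{G}$, finite nonempty admissible action sets $U_C(s)$ (controller) and $U_A(s)$ (adversary) at each state $s$, and transition probabilities $Pr_\mathcal{G}(s,u_C,u_A,s')$. It is the product of a stochastic game with a deterministic Rabin automaton of an LTL formula; $\mathcal{E}\subseteq S_\mathcal{G}$ is a given set of accepting states (the union of the state sets of the generalized accepting maximal end components of the product game; for this statement only its role as target set matters). The game is modified as follows: a dummy state $dest$ is added to $S_\mathcal{G}$, and a controller action $d$ is made available at the states of $\mathcal{E}\cup\{dest\}$ with $Pr_\mathcal{G}(s,d,u_A,dest)=1$ for all $s\in\mathcal{E}\cup\{dest\}$ and all $u_A\in U_A(s)$ ($d$ is the only controller action at $dest$). All other transitions are unchanged. In the max-min, $\mu(s,\cdot)$ ranges over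 probability distributions on $U_C(s)$ and $\tau(s,\cdot)$ over probability distributions on $U_A(s)$. Value iteration with tolerance $\delta>0$: set $v^0=0$; $v^1(s)=1$ for $s\in\mathcal{E}\cup\{dest\}$ and $v^1(s)=0$ otherwise; $k=0$. While $\max_s|v^{k+1}(s)-v^k(s)|>\delta$: increase $k$ by one, and set, for $s\notin\mathcal{E}\cup\{dest\}$, $$v^{k+1}(s)=\max_{\mu}\min_{\tau}\sum_{s'}\sum_{u_C\in U_C(s)}\sum_{u_A\in U_A(s)}v^k(s')\,\mu(s,u_C)\,\tau(s,u_A)\,Pr_\mathcal{G}(s,u_C,u_A,s'),$$ while $v^{k+1}(s)=v^k(s)=1$ for $s\in\mathcal{E}\cup\{dest\}$. After the loop terminates, $v^k$ for larger $k$ denotes the last computed vector. *)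

theory Defs
  imports "HOL-Probability.Probability"
begin

record ('s, 'c, 'a) game =
  game_states :: "'s set"
  ctrl :: "'s \<Rightarrow> 'c set"
  adv :: "'s \<Rightarrow> 'a set"
  trans_prob :: "'s \<Rightarrow> 'c \<Rightarrow> 'a \<Rightarrow> 's pmf"

definition concurrent_game :: "('s, 'c, 'a) game \<Rightarrow> bool" where
  "concurrent_game G \<longleftrightarrow>
     finite (game_states G) \<and>
     (\<forall>s\<in>game_states G.
        finite (ctrl G s) \<and> ctrl G s \<noteq> {} \<and>
        finite (adv G s) \<and> adv G s \<noteq> {} \<and>
        (\<forall>u\<in>ctrl G s. \<forall>a\<in>adv G s. set_pmf (trans_prob G s u a) \<subseteq> game_states G))"

text \<open>
  In the modified game the state \<open>None\<close> is the dummy state \<open>dest\<close> and the controller action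
  \<open>None\<close> is the action \<open>d\<close>, so both are new. The set \<open>D\<close> is the adversary's action set at
  \<open>dest\<close>, which the construction leaves open.
\<close>

definition modified_game ::
  "('s, 'c, 'a) game \<Rightarrow> 's set \<Rightarrow> 'a set \<Rightarrow> ('s option, 'c option, 'a) game" where
  "modified_game G E D =
     \<lparr> game_states = insert None (Some ` game_states G),
       ctrl = (\<lambda>x. case x of
                 None \<Rightarrow> {None}
               | Some s \<Rightarrow> Some ` ctrl G s \<union> (if s \<in> E then {None} else {})),
       adv = (\<lambda>x. case x of None \<Rightarrow> D | Some s \<Rightarrow> adv G s),
       trans_prob = (\<lambda>x u a. case (x, u) of
                   (Some s, Some c) \<Rightarrow> map_pmf Some (trans_prob G s c a)
                 | _ \<Rightarrow> return_pmf None) \<rparr>"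

lemma concurrent_game_modified_game:
  assumes "concurrent_game G" "finite D" "D \<noteq> {}"
  shows "concurrent_game (modified_game G E D)"
  using assms unfolding concurrent_game_def modified_game_def
  by (auto split: option.splits) (meson imageI subsetD)+

definition target :: "'s set \<Rightarrow> 's option set" where
  "target E = insert None (Some ` E)"

definition mixed :: "'u set \<Rightarrow> 'u pmf set" where
  "mixed A = {p. set_pmf p \<subseteq> A}"

definition payoff ::
  "('s, 'c, 'a) game \<Rightarrow> ('s \<Rightarrow> real) \<Rightarrow> 's \<Rightarrow> 'c pmf \<Rightarrow> 'a pmf \<Rightarrow> real" where
  "payoff G v s \<mu> \<tau> =
     (\<Sum>u\<in>ctrl G s. \<Sum>a\<in>adv G s. \<Sum>s'\<in>game_states G.
        pmf \<mu> u * pmf \<tau> a * v s' * pmf (trans_prob G s u a) s')"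

definition min_payoff :: "('s, 'c, 'a) game \<Rightarrow> ('s \<Rightarrow> real) \<Rightarrow> 's \<Rightarrow> 'c pmf \<Rightarrow> real" where
  "min_payoff G v s \<mu> = (INF \<tau>\<in>mixed (adv G s). payoff G v s \<mu> \<tau>)"

definition maxmin :: "('s, 'c, 'a) game \<Rightarrow> ('s \<Rightarrow> real) \<Rightarrow> 's \<Rightarrow> real" where
  "maxmin G v s = (SUP \<mu>\<in>mixed (ctrl G s). min_payoff G v s \<mu>)"

text \<open>
  \<open>is_maxmin G v s m\<close> states that \<open>m\<close> is the maximum over \<open>\<mu>\<close> of the minimum over \<open>\<tau>\<close> of the
  payoff, with all these extrema attained.
\<close>

definition is_maxmin :: "('s, 'c, 'a) game \<Rightarrow> ('s \<Rightarrow> real) \<Rightarrow> 's \<Rightarrow> real \<Rightarrow> bool" where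
  "is_maxmin G v s m \<longleftrightarrow>
     (\<exists>f. (\<forall>\<mu>\<in>mixed (ctrl G s).
             (\<exists>\<tau>\<in>mixed (adv G s). payoff G v s \<mu> \<tau> = f \<mu>) \<and>
             (\<forall>\<tau>\<in>mixed (adv G s). f \<mu> \<le> payoff G v s \<mu> \<tau>)) \<and>
          (\<exists>\<mu>\<in>mixed (ctrl G s). f \<mu> = m) \<and>
          (\<forall>\<mu>\<in>mixed (ctrl G s). f \<mu> \<le> m))"

text \<open>
  By compactness the extrema always exist in a concurrent game, so that \<open>maxmin\<close>, although
  written with \<open>SUP\<close> and \<open>INF\<close>, is the max-min.
\<close>

lemma mixed_attains_max:
  fixes F :: "'u pmf \<Rightarrow> real"
  assumes A: "finite A" "A \<noteq> {}"
    and L: "\<And>p q. p \<in> mixed A \<Longrightarrow> q \<in> mixed A \<Longrightarrow>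
              \<bar>F p - F q\<bar> \<le> C * (\<Sum>a\<in>A. \<bar>pmf p a - pmf q a\<bar>)"
  obtains p where "p \<in> mixed A" "\<And>q. q \<in> mixed A \<Longrightarrow> F q \<le> F p"
proof -
  define X where "X = {x :: 'u \<Rightarrow> real. (\<forall>a. 0 \<le> x a) \<and> (\<forall>a. a \<notin> A \<longrightarrow> x a = 0) \<and> sum x A = 1}"
  have pmf_X: "pmf p \<in> X" if "p \<in> mixed A" for p
  proof -
    have "pmf p a = 0" if "a \<notin> A" for a
      using \<open>p \<in> mixed A\<close> that by (auto simp: mixed_def set_pmf_iff)
    moreover have "sum (pmf p) A = 1"
      using \<open>p \<in> mixed A\<close> A(1) by (intro sum_pmf_eq_1) (auto simp: mixed_def)
    ultimately show ?thesis
      by (simp add: X_def)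
  qed
  have emb: "pmf (embed_pmf x) = x \<and> embed_pmf x \<in> mixed A" if "x \<in> X" for x
  proof -
    have x: "\<And>a. 0 \<le> x a" "\<And>a. a \<notin> A \<Longrightarrow> x a = 0" "sum x A = 1"
      using that by (auto simp: X_def)
    have "(\<integral>\<^sup>+a. ennreal (x a) \<partial>count_space UNIV) = (\<integral>\<^sup>+a. ennreal (x a) \<partial>count_space A)"
      by (rule nn_integral_count_space_eq) (use x(2) in auto)
    also have "\<dots> = (\<Sum>a\<in>A. ennreal (x a))"
      by (rule nn_integral_count_space_finite[OF A(1)])
    also have "\<dots> = 1"
      using x by (subst sum_ennreal) auto
    finally have 1: "(\<integral>\<^sup>+a. ennreal (x a) \<partial>count_space UNIV) = 1" .
    have 2: "pmf (embed_pmf x) a = x a" for a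
      by (rule pmf_embed_pmf[OF x(1) 1])
    then have "set_pmf (embed_pmf x) \<subseteq> A"
      using x(2) unfolding set_pmf_iff subset_iff by metis
    with 2 show ?thesis
      by (auto simp: mixed_def)
  qed
  have cont1: "continuous_on UNIV (\<lambda>x :: 'u \<Rightarrow> real. x a)" for a
    by (rule continuous_on_product_coordinates)
  have "compactin (product_topology (\<lambda>_. euclidean) UNIV) (PiE UNIV (\<lambda>_ :: 'u. {0..1::real}))"
    by (subst compactin_PiE) (auto simp: compactin_euclidean_iff)
  then have cB: "compact (PiE UNIV (\<lambda>_ :: 'u. {0..1::real}))"
    by (simp add: euclidean_product_topology compactin_euclidean_iff)
  have "X = PiE UNIV (\<lambda>_. {0..1}) \<inter>
      ((\<Inter>a. {x. 0 \<le> x a}) \<inter> (\<Inter>a\<in>-A. {x. x a = 0}) \<inter> {x. sum x A = 1})"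
    (is "_ = _ \<inter> ?Y")
  proof -
    have "x a \<le> 1" if "x \<in> X" for x a
      using emb[OF that] pmf_le_1[of "embed_pmf x" a] by simp
    then show ?thesis
      by (auto simp: X_def PiE_UNIV_domain Pi_def)
  qed
  moreover have "closed ?Y"
    by (intro closed_Int closed_INT ballI closed_Collect_le closed_Collect_eq
        continuous_on_sum cont1 continuous_on_const)
  ultimately have cX: "compact X"
    using cB compact_Int_closed by metis
  have "X \<noteq> {}"
  proof -
    obtain a where "a \<in> A" using A(2) by auto
    then have "return_pmf a \<in> mixed A" by (auto simp: mixed_def)
    then show ?thesis using pmf_X by auto
  qed
  moreover have "continuous_on X (\<lambda>x. F (embed_pmf x))"
    unfolding continuous_on_def
  proof
    fix x assume x: "x \<in> X"
    have "((\<lambda>y. C * (\<Sum>a\<in>A. \<bar>y a - x a\<bar>)) \<longlongrightarrow> C * (\<Sum>a\<in>A. \<bar>x a - x a\<bar>)) (at x within X)"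
      by (intro tendsto_intros)
         (use continuous_on_subset[OF cont1, of X] x in \<open>auto simp: continuous_on_def\<close>)
    then have lim: "((\<lambda>y. C * (\<Sum>a\<in>A. \<bar>y a - x a\<bar>)) \<longlongrightarrow> 0) (at x within X)"
      by simp
    have "((\<lambda>y. F (embed_pmf y) - F (embed_pmf x)) \<longlongrightarrow> 0) (at x within X)"
    proof (rule Lim_null_comparison[OF _ lim])
      show "\<forall>\<^sub>F y in at x within X.
          norm (F (embed_pmf y) - F (embed_pmf x)) \<le> C * (\<Sum>a\<in>A. \<bar>y a - x a\<bar>)"
      proof -
        have "norm (F (embed_pmf y) - F (embed_pmf x)) \<le> C * (\<Sum>a\<in>A. \<bar>y a - x a\<bar>)"
          if "y \<in> X" for y
          using L[of "embed_pmf y" "embed_pmf x"] emb[OF x] emb[OF that] by simp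
        then show ?thesis
          by (auto simp: eventually_at_filter)
      qed
    qed
    then show "((\<lambda>y. F (embed_pmf y)) \<longlongrightarrow> F (embed_pmf x)) (at x within X)"
      by (rule LIM_zero_cancel)
  qed
  ultimately obtain x where x: "x \<in> X" "\<And>y. y \<in> X \<Longrightarrow> F (embed_pmf y) \<le> F (embed_pmf x)"
    using continuous_attains_sup[OF cX] by blast
  show thesis
  proof (rule that)
    show "embed_pmf x \<in> mixed A" using emb x by auto
    fix q assume q: "q \<in> mixed A"
    have "embed_pmf (pmf q) = q"
      using emb[OF pmf_X[OF q]] by (intro pmf_eqI) simp
    then show "F q \<le> F (embed_pmf x)" using x(2)[OF pmf_X[OF q]] by simp
  qed
qed

lemma payoff_lipschitz:
  fixes G :: "('s, 'c, 'a) game"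
  obtains C where
    "\<And>\<mu> \<mu>' \<tau>. \<bar>payoff G v s \<mu> \<tau> - payoff G v s \<mu>' \<tau>\<bar> \<le> C * (\<Sum>u\<in>ctrl G s. \<bar>pmf \<mu> u - pmf \<mu>' u\<bar>)"
    "\<And>\<mu> \<tau> \<tau>'. \<bar>payoff G v s \<mu> \<tau> - payoff G v s \<mu> \<tau>'\<bar> \<le> C * (\<Sum>a\<in>adv G s. \<bar>pmf \<tau> a - pmf \<tau>' a\<bar>)"
proof -
  define w where "w u a = (\<Sum>s'\<in>game_states G. v s' * pmf (trans_prob G s u a) s')" for u a
  define C where "C = (\<Sum>u\<in>ctrl G s. \<Sum>a\<in>adv G s. \<bar>w u a\<bar>)"
  have p: "payoff G v s \<mu> \<tau> = (\<Sum>u\<in>ctrl G s. \<Sum>a\<in>adv G s. pmf \<mu> u * pmf \<tau> a * w u a)" for \<mu> \<tau>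
    by (simp add: payoff_def w_def sum_distrib_left mult.assoc)
  have aux: "(\<Sum>u\<in>ctrl G s. \<Sum>a\<in>adv G s. x u a * \<bar>w u a\<bar>) \<le> S * C"
    if "\<And>u a. u \<in> ctrl G s \<Longrightarrow> a \<in> adv G s \<Longrightarrow> x u a \<le> S" for x S
    unfolding C_def sum_distrib_left using that by (intro sum_mono mult_right_mono) auto
  have 1: "\<bar>payoff G v s \<mu> \<tau> - payoff G v s \<mu>' \<tau>\<bar> \<le> C * (\<Sum>u\<in>ctrl G s. \<bar>pmf \<mu> u - pmf \<mu>' u\<bar>)"
    for \<mu> \<mu>' \<tau>
  proof (cases "finite (ctrl G s)")
    case True
    have "payoff G v s \<mu> \<tau> - payoff G v s \<mu>' \<tau> =
        (\<Sum>u\<in>ctrl G s. \<Sum>a\<in>adv G s. (pmf \<mu> u - pmf \<mu>' u) * pmf \<tau> a * w u a)"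
      by (simp add: p sum_subtractf left_diff_distrib)
    also have "\<bar>\<dots>\<bar> \<le> (\<Sum>u\<in>ctrl G s. \<Sum>a\<in>adv G s. \<bar>(pmf \<mu> u - pmf \<mu>' u) * pmf \<tau> a * w u a\<bar>)"
      by (intro order_trans[OF sum_abs] sum_mono sum_abs)
    also have "\<dots> = (\<Sum>u\<in>ctrl G s. \<Sum>a\<in>adv G s. (\<bar>pmf \<mu> u - pmf \<mu>' u\<bar> * pmf \<tau> a) * \<bar>w u a\<bar>)"
      by (simp add: abs_mult)
    also have "\<dots> \<le> (\<Sum>u\<in>ctrl G s. \<bar>pmf \<mu> u - pmf \<mu>' u\<bar>) * C"
    proof (rule aux)
      fix u a assume "u \<in> ctrl G s"
      have "\<bar>pmf \<mu> u - pmf \<mu>' u\<bar> * pmf \<tau> a \<le> \<bar>pmf \<mu> u - pmf \<mu>' u\<bar>"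
        by (simp add: mult_left_le pmf_le_1)
      also have "\<dots> \<le> (\<Sum>u\<in>ctrl G s. \<bar>pmf \<mu> u - pmf \<mu>' u\<bar>)"
        using True \<open>u \<in> ctrl G s\<close> by (intro member_le_sum) auto
      finally show "\<bar>pmf \<mu> u - pmf \<mu>' u\<bar> * pmf \<tau> a \<le> (\<Sum>u\<in>ctrl G s. \<bar>pmf \<mu> u - pmf \<mu>' u\<bar>)" .
    qed
    finally show ?thesis by (simp add: mult.commute)
  qed (simp add: p)
  have 2: "\<bar>payoff G v s \<mu> \<tau> - payoff G v s \<mu> \<tau>'\<bar> \<le> C * (\<Sum>a\<in>adv G s. \<bar>pmf \<tau> a - pmf \<tau>' a\<bar>)"
    for \<mu> \<tau> \<tau>'
  proof (cases "finite (adv G s)")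
    case True
    have "payoff G v s \<mu> \<tau> - payoff G v s \<mu> \<tau>' =
        (\<Sum>u\<in>ctrl G s. \<Sum>a\<in>adv G s. pmf \<mu> u * (pmf \<tau> a - pmf \<tau>' a) * w u a)"
      by (simp add: p sum_subtractf left_diff_distrib right_diff_distrib)
    also have "\<bar>\<dots>\<bar> \<le> (\<Sum>u\<in>ctrl G s. \<Sum>a\<in>adv G s. \<bar>pmf \<mu> u * (pmf \<tau> a - pmf \<tau>' a) * w u a\<bar>)"
      by (intro order_trans[OF sum_abs] sum_mono sum_abs)
    also have "\<dots> = (\<Sum>u\<in>ctrl G s. \<Sum>a\<in>adv G s. (pmf \<mu> u * \<bar>pmf \<tau> a - pmf \<tau>' a\<bar>) * \<bar>w u a\<bar>)"
      by (simp add: abs_mult)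
    also have "\<dots> \<le> (\<Sum>a\<in>adv G s. \<bar>pmf \<tau> a - pmf \<tau>' a\<bar>) * C"
    proof (rule aux)
      fix u a assume "a \<in> adv G s"
      have "pmf \<mu> u * \<bar>pmf \<tau> a - pmf \<tau>' a\<bar> \<le> \<bar>pmf \<tau> a - pmf \<tau>' a\<bar>"
        by (simp add: mult_left_le_one_le pmf_le_1)
      also have "\<dots> \<le> (\<Sum>a\<in>adv G s. \<bar>pmf \<tau> a - pmf \<tau>' a\<bar>)"
        using True \<open>a \<in> adv G s\<close> by (intro member_le_sum) auto
      finally show "pmf \<mu> u * \<bar>pmf \<tau> a - pmf \<tau>' a\<bar> \<le> (\<Sum>a\<in>adv G s. \<bar>pmf \<tau> a - pmf \<tau>' a\<bar>)" .
    qed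
    finally show ?thesis by (simp add: mult.commute)
  qed (simp add: p)
  show thesis using that[OF 1 2] .
qed

lemma is_maxmin_iff_maxmin:
  assumes "concurrent_game G" and s: "s \<in> game_states G"
  shows "is_maxmin G v s m \<longleftrightarrow> m = maxmin G v s"
proof -
  let ?M = "mixed (ctrl G s)" and ?T = "mixed (adv G s)"
  have fin: "finite (ctrl G s)" "ctrl G s \<noteq> {}" "finite (adv G s)" "adv G s \<noteq> {}"
    using assms unfolding concurrent_game_def by blast+
  obtain C where
    C1: "\<And>\<mu> \<mu>' \<tau>. \<bar>payoff G v s \<mu> \<tau> - payoff G v s \<mu>' \<tau>\<bar> \<le> C * (\<Sum>u\<in>ctrl G s. \<bar>pmf \<mu> u - pmf \<mu>' u\<bar>)"
    and C2: "\<And>\<mu> \<tau> \<tau>'. \<bar>payoff G v s \<mu> \<tau> - payoff G v s \<mu> \<tau>'\<bar> \<le> C * (\<Sum>a\<in>adv G s. \<bar>pmf \<tau> a - pmf \<tau>' a\<bar>)"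
    by (rule payoff_lipschitz[of G v s]) blast
  have min_unique: "y = min_payoff G v s \<mu>"
    if "\<exists>\<tau>\<in>?T. payoff G v s \<mu> \<tau> = y" "\<forall>\<tau>\<in>?T. y \<le> payoff G v s \<mu> \<tau>" for \<mu> y
    unfolding min_payoff_def using that by (intro cInf_eq_minimum[symmetric]) auto
  have min_ex: "(\<exists>\<tau>\<in>?T. payoff G v s \<mu> \<tau> = min_payoff G v s \<mu>) \<and>
      (\<forall>\<tau>\<in>?T. min_payoff G v s \<mu> \<le> payoff G v s \<mu> \<tau>)" for \<mu>
  proof -
    have "\<bar>- payoff G v s \<mu> p - - payoff G v s \<mu> q\<bar> \<le> C * (\<Sum>a\<in>adv G s. \<bar>pmf p a - pmf q a\<bar>)" for p q
      using C2[of \<mu> p q] by linarith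
    from mixed_attains_max[OF fin(3,4) this]
    obtain \<tau> where \<tau>: "\<tau> \<in> ?T" "\<And>q. q \<in> ?T \<Longrightarrow> - payoff G v s \<mu> q \<le> - payoff G v s \<mu> \<tau>"
      by blast
    then have "payoff G v s \<mu> \<tau> = min_payoff G v s \<mu>"
      by (intro min_unique) auto
    with \<tau> show ?thesis by auto
  qed
  have half: "min_payoff G v s p - min_payoff G v s q \<le> C * (\<Sum>u\<in>ctrl G s. \<bar>pmf p u - pmf q u\<bar>)" for p q
  proof -
    obtain \<tau> where "\<tau> \<in> ?T" "payoff G v s q \<tau> = min_payoff G v s q"
      using min_ex by blast
    moreover have "min_payoff G v s p \<le> payoff G v s p \<tau>"
      using min_ex \<open>\<tau> \<in> ?T\<close> by blast
    ultimately show ?thesis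
      using C1[of p \<tau> q] by linarith
  qed
  have "\<bar>min_payoff G v s p - min_payoff G v s q\<bar> \<le> C * (\<Sum>u\<in>ctrl G s. \<bar>pmf p u - pmf q u\<bar>)" for p q
    using half[of p q] half[of q p] by (simp add: abs_le_iff abs_minus_commute)
  from mixed_attains_max[OF fin(1,2) this]
  obtain \<mu> where \<mu>: "\<mu> \<in> ?M" "\<And>q. q \<in> ?M \<Longrightarrow> min_payoff G v s q \<le> min_payoff G v s \<mu>"
    by blast
  have max_unique: "y = maxmin G v s"
    if "\<exists>\<mu>\<in>?M. min_payoff G v s \<mu> = y" "\<forall>\<mu>\<in>?M. min_payoff G v s \<mu> \<le> y" for y
    unfolding maxmin_def using that by (intro cSup_eq_maximum[symmetric]) auto
  have max: "min_payoff G v s \<mu> = maxmin G v s"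
    using \<mu> by (intro max_unique) auto
  show ?thesis
  proof
    assume "is_maxmin G v s m"
    then obtain f where f: "\<forall>\<mu>\<in>?M. (\<exists>\<tau>\<in>?T. payoff G v s \<mu> \<tau> = f \<mu>) \<and> (\<forall>\<tau>\<in>?T. f \<mu> \<le> payoff G v s \<mu> \<tau>)"
      "\<exists>\<mu>\<in>?M. f \<mu> = m" "\<forall>\<mu>\<in>?M. f \<mu> \<le> m"
      unfolding is_maxmin_def by blast
    then have "\<forall>\<mu>\<in>?M. f \<mu> = min_payoff G v s \<mu>"
      using min_unique by blast
    with f show "m = maxmin G v s"
      by (intro max_unique) auto
  next
    assume m: "m = maxmin G v s"
    show "is_maxmin G v s m"
      unfolding is_maxmin_def m max[symmetric]
      using min_ex \<mu> by (intro exI[of _ "min_payoff G v s"] conjI) blast+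
  qed
qed

definition sup_dist :: "'s set \<Rightarrow> ('s \<Rightarrow> real) \<Rightarrow> ('s \<Rightarrow> real) \<Rightarrow> real" where
  "sup_dist S f g = Max ((\<lambda>s. \<bar>f s - g s\<bar>) ` S)"

text \<open>
  Once the loop test fails, the last computed vector is repeated, and for \<open>\<delta> \<ge> 0\<close> the test
  keeps failing from then on.
\<close>

fun value_iter :: "('s, 'c, 'a) game \<Rightarrow> 's set \<Rightarrow> real \<Rightarrow> nat \<Rightarrow> 's \<Rightarrow> real" where
  "value_iter G T \<delta> 0 = (\<lambda>s. 0)"
| "value_iter G T \<delta> (Suc 0) = (\<lambda>s. if s \<in> T then 1 else 0)"
| "value_iter G T \<delta> (Suc (Suc k)) =
     (if sup_dist (game_states G) (value_iter G T \<delta> (Suc k)) (value_iter G T \<delta> k) > \<delta>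
      then (\<lambda>s. if s \<in> T then 1 else maxmin G (value_iter G T \<delta> (Suc k)) s)
      else value_iter G T \<delta> (Suc k))"

end

theory Submission
  imports Defs
begin

text \<open>
  Without a stopping test the iterates increase and stay below 1, so they converge. The one-step
  operator is nonexpansive in the sup norm, so the limit is a fixed point of it; on the target
  set the value 1 is the max-min because the controller can move to \<open>dest\<close> surely.
  For the tolerance: only finitely many step sizes precede an index \<open>N\<close> from which the iterates
  are close to the limit, and \<open>\<delta>\<close> is taken below all the positive ones. The loop then
  stops after \<open>N\<close> or at a step of size 0, that is, at the limit itself.
\<close>

section \<open>The max-min as a monotone, nonexpansive operator\<close>

lemma concurrent_gameD:
  assumes "concurrent_game G"
  shows "finite (game_states G)"
    and "s \<in> game_states G \<Longrightarrow> finite (ctrl G s)"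
    and "s \<in> game_states G \<Longrightarrow> finite (adv G s)"
    and "s \<in> game_states G \<Longrightarrow> u \<in> ctrl G s \<Longrightarrow> a \<in> adv G s \<Longrightarrow>
           set_pmf (trans_prob G s u a) \<subseteq> game_states G"
  using assms unfolding concurrent_game_def by blast+

text \<open>The products of \<open>pmf \<mu> u\<close>, \<open>pmf \<tau> a\<close> and the
  transition probability are nonnegative weights of total mass 1, so a constant added to the values
  passes through the payoff unchanged.\<close>

lemma payoff_le_add:
  assumes G: "concurrent_game G" and s: "s \<in> game_states G"
    and \<mu>: "\<mu> \<in> mixed (ctrl G s)" and \<tau>: "\<tau> \<in> mixed (adv G s)"
    and le: "\<And>s'. s' \<in> game_states G \<Longrightarrow> v s' \<le> w s' + c"
  shows "payoff G v s \<mu> \<tau> \<le> payoff G w s \<mu> \<tau> + c"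
proof -
  note fin = concurrent_gameD(1)[OF G] concurrent_gameD(2,3)[OF G s]
  have 1: "(\<Sum>s'\<in>game_states G. pmf (trans_prob G s u a) s') = 1"
    if "u \<in> ctrl G s" "a \<in> adv G s" for u a
    by (rule sum_pmf_eq_1[OF fin(1) concurrent_gameD(4)[OF G s that]])
  have "payoff G v s \<mu> \<tau> \<le> (\<Sum>u\<in>ctrl G s. \<Sum>a\<in>adv G s. \<Sum>s'\<in>game_states G.
        pmf \<mu> u * pmf \<tau> a * (w s' + c) * pmf (trans_prob G s u a) s')"
    unfolding payoff_def
    by (intro sum_mono mult_right_mono mult_left_mono le) auto
  also have "\<dots> = payoff G w s \<mu> \<tau> + (\<Sum>u\<in>ctrl G s. \<Sum>a\<in>adv G s.
        pmf \<mu> u * pmf \<tau> a * c * (\<Sum>s'\<in>game_states G. pmf (trans_prob G s u a) s'))"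
    by (simp add: payoff_def sum.distrib sum_distrib_left algebra_simps)
  also have "\<dots> = payoff G w s \<mu> \<tau> + (\<Sum>u\<in>ctrl G s. \<Sum>a\<in>adv G s. pmf \<mu> u * pmf \<tau> a * c)"
    by (simp add: 1)
  also have "\<dots> = payoff G w s \<mu> \<tau> + sum (pmf \<mu>) (ctrl G s) * sum (pmf \<tau>) (adv G s) * c"
    by (subst sum_product) (simp add: sum_distrib_right)
  also have "\<dots> = payoff G w s \<mu> \<tau> + c"
    using \<mu> \<tau> fin by (simp add: mixed_def sum_pmf_eq_1)
  finally show ?thesis .
qed

text \<open>An optimal \<open>\<mu>\<close> for \<open>v\<close> is played against a best reply to
  it under \<open>w\<close>. With \<open>c = 0\<close> this is monotonicity; used in both directions
  it is nonexpansiveness in the sup norm.\<close>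

lemma maxmin_le_add:
  assumes G: "concurrent_game G" and s: "s \<in> game_states G"
    and le: "\<And>s'. s' \<in> game_states G \<Longrightarrow> v s' \<le> w s' + c"
  shows "maxmin G v s \<le> maxmin G w s + c"
proof -
  have "is_maxmin G v s (maxmin G v s)" "is_maxmin G w s (maxmin G w s)"
    using is_maxmin_iff_maxmin[OF G s] by blast+
  then obtain f g \<mu> where
    f: "\<forall>\<mu>\<in>mixed (ctrl G s). \<forall>\<tau>\<in>mixed (adv G s). f \<mu> \<le> payoff G v s \<mu> \<tau>"
    and g: "\<forall>\<mu>\<in>mixed (ctrl G s). \<exists>\<tau>\<in>mixed (adv G s). payoff G w s \<mu> \<tau> = g \<mu>"
    and \<mu>: "\<mu> \<in> mixed (ctrl G s)" "f \<mu> = maxmin G v s"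
    and g_le: "\<forall>\<mu>\<in>mixed (ctrl G s). g \<mu> \<le> maxmin G w s"
    unfolding is_maxmin_def by metis
  obtain \<tau> where \<tau>: "\<tau> \<in> mixed (adv G s)" "payoff G w s \<mu> \<tau> = g \<mu>"
    using g \<mu> by blast
  have "maxmin G v s \<le> payoff G v s \<mu> \<tau>"
    using f \<mu> \<tau> by force
  also have "\<dots> \<le> g \<mu> + c"
    unfolding \<tau>(2)[symmetric] by (rule payoff_le_add[OF G s \<mu>(1) \<tau>(1) le])
  finally show ?thesis
    using g_le \<mu>(1) by force
qed

lemma maxmin_ge:
  assumes G: "concurrent_game G" and s: "s \<in> game_states G"
    and \<mu>: "\<mu> \<in> mixed (ctrl G s)"
    and le: "\<And>\<tau>. \<tau> \<in> mixed (adv G s) \<Longrightarrow> c \<le> payoff G v s \<mu> \<tau>"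
  shows "c \<le> maxmin G v s"
proof -
  have "is_maxmin G v s (maxmin G v s)"
    using is_maxmin_iff_maxmin[OF G s] by blast
  then show ?thesis
    unfolding is_maxmin_def using \<mu> le by (metis order_trans)
qed

text \<open>Serves twice: it makes the first iterate an instance of the general step, and it turns
  \<open>maxmin_le_add\<close> into the upper bound 1.\<close>

lemma maxmin_0:
  assumes "concurrent_game G" "s \<in> game_states G"
  shows "maxmin G (\<lambda>_. 0) s = 0"
proof -
  have "is_maxmin G (\<lambda>_. 0) s (maxmin G (\<lambda>_. 0) s)"
    using is_maxmin_iff_maxmin[OF assms] by blast
  then show ?thesis
    unfolding is_maxmin_def by (auto simp: payoff_def)
qed

section \<open>The sup distance and the stopping test\<close>

lemma sup_dist_nonneg:
  assumes "finite S" "S \<noteq> {}"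
  shows "0 \<le> sup_dist S f g"
  using assms unfolding sup_dist_def by (auto simp: Max_ge_iff)

lemma sup_dist_less_iff:
  assumes "finite S" "S \<noteq> {}"
  shows "sup_dist S f g < c \<longleftrightarrow> (\<forall>s\<in>S. \<bar>f s - g s\<bar> < c)"
  using assms unfolding sup_dist_def by simp

lemma sup_dist_eq_0_iff:
  assumes "finite S" "S \<noteq> {}"
  shows "sup_dist S f g = 0 \<longleftrightarrow> (\<forall>s\<in>S. f s = g s)"
proof -
  have "sup_dist S f g \<le> 0 \<longleftrightarrow> (\<forall>s\<in>S. f s = g s)"
    using assms unfolding sup_dist_def by simp
  then show ?thesis
    using sup_dist_nonneg[OF assms, of f g] by linarith
qed

text \<open>With tolerance \<open>-1\<close> the loop never stops.\<close>

lemma value_iter_untruncated: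
  assumes "finite (game_states G)" "game_states G \<noteq> {}"
  shows "value_iter G T (-1) (Suc (Suc k)) =
    (\<lambda>s. if s \<in> T then 1 else maxmin G (value_iter G T (-1) (Suc k)) s)"
  using sup_dist_nonneg[OF assms, of "value_iter G T (-1) (Suc k)" "value_iter G T (-1) k"]
  by auto

text \<open>The prescribed first iterate is also the general step applied to the zero vector, whose
  max-min is 0, so one recursion covers every index.\<close>

lemma value_iter_untruncated_step:
  assumes G: "concurrent_game G" and s: "s \<in> game_states G"
  shows "value_iter G T (-1) (Suc k) s =
    (if s \<in> T then 1 else maxmin G (value_iter G T (-1) k) s)"
proof (cases k)
  case 0
  then show ?thesis using maxmin_0[OF G s] by simp
next
  case (Suc j)
  have "game_states G \<noteq> {}" using s by auto
  from value_iter_untruncated[OF concurrent_gameD(1)[OF G] this] show ?thesis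
    unfolding Suc by simp
qed

text \<open>The two runs agree with \<open>j = k\<close> as long as no test has failed; from then on
  \<open>j\<close> stays at the step whose size was at most \<open>\<delta>\<close>.\<close>

lemma value_iter_eq_untruncated:
  assumes "finite (game_states G)" "game_states G \<noteq> {}" "0 \<le> \<delta>"
  shows "\<exists>j\<le>k. value_iter G T \<delta> (Suc k) = value_iter G T (-1) (Suc j) \<and>
    (j = k \<or> sup_dist (game_states G) (value_iter G T (-1) (Suc j)) (value_iter G T (-1) j) \<le> \<delta>)"
    (is "\<exists>j\<le>k. ?v (Suc k) = ?w (Suc j) \<and> (j = k \<or> ?d (?w (Suc j)) (?w j) \<le> \<delta>)")
proof -
  \<comment> \<open>The disjunction for \<open>?v k\<close> is carried along because the test compares two successive iterates.\<close>
  have "\<exists>j\<le>k. ?v (Suc k) = ?w (Suc j) \<and>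
      (j = k \<and> ?v k = ?w k \<or> ?v k = ?v (Suc k) \<and> ?d (?w (Suc j)) (?w j) \<le> \<delta>)"
  proof (induction k)
    case 0
    show ?case by (intro exI[of _ 0]) simp
  next
    case (Suc k)
    then obtain j where j: "j \<le> k" "?v (Suc k) = ?w (Suc j)"
      "j = k \<and> ?v k = ?w k \<or> ?v k = ?v (Suc k) \<and> ?d (?w (Suc j)) (?w j) \<le> \<delta>"
      by blast
    show ?case
    proof (cases "?d (?v (Suc k)) (?v k) > \<delta>")
      case True
      \<comment> \<open>Had the loop already stopped, the two compared vectors would coincide, and
        their distance 0 could not exceed \<open>\<delta>\<close>.\<close>
      have "?d (?v (Suc k)) (?v (Suc k)) = 0"
        using sup_dist_eq_0_iff[OF assms(1,2)] by blast
      with True j(3) assms(3) have "j = k" by auto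
      moreover have "?v (Suc (Suc k)) = ?w (Suc (Suc k))"
        unfolding value_iter_untruncated[OF assms(1,2)] using True j(2) \<open>j = k\<close>
        by (subst value_iter.simps(3)) (simp del: value_iter.simps cong: if_cong)
      ultimately show ?thesis
        using j(2) by (intro exI[of _ "Suc k"]) simp
    next
      case False
      then have "?v (Suc (Suc k)) = ?v (Suc k)"
        by simp
      \<comment> \<open>Either the loop stops now, with \<open>j = k\<close> and the present test,
        or it stopped earlier and \<open>j\<close> is kept.\<close>
      moreover have "?d (?w (Suc j)) (?w j) \<le> \<delta>"
        using j False by fastforce
      ultimately show ?thesis
        using j(1,2) by (intro exI[of _ j]) simp
    qed
  qed
  then show ?thesis by blast
qed

section \<open>Convergence of the iterates without a stopping test\<close>

lemma value_iter_untruncated_mono: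
  assumes G: "concurrent_game G" and s: "s \<in> game_states G"
  shows "value_iter G T (-1) k s \<le> value_iter G T (-1) (Suc k) s"
  using s
proof (induction k arbitrary: s)
  case 0
  then show ?case by simp
next
  case (Suc k)
  have "maxmin G (value_iter G T (-1) k) s \<le> maxmin G (value_iter G T (-1) (Suc k)) s + 0"
    using Suc by (intro maxmin_le_add[OF G]) simp_all
  then show ?case
    unfolding value_iter_untruncated_step[OF G Suc.prems] by simp
qed

lemma value_iter_untruncated_le_1:
  assumes G: "concurrent_game G" and s: "s \<in> game_states G"
  shows "value_iter G T (-1) k s \<le> 1"
  using s
proof (induction k arbitrary: s)
  case 0
  then show ?case by simp
next
  case (Suc k)
  have "maxmin G (value_iter G T (-1) k) s \<le> maxmin G (\<lambda>_. 0) s + 1"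
    using Suc by (intro maxmin_le_add[OF G]) simp_all
  then show ?case
    using maxmin_0[OF G Suc.prems] value_iter_untruncated_step[OF G Suc.prems, of T k] by simp
qed

text \<open>The max-min reads a vector only on \<open>game_states G\<close>, so agreement of two
  successive iterates there propagates to all later ones.\<close>

lemma value_iter_untruncated_stationary:
  assumes G: "concurrent_game G"
    and eq: "\<And>s. s \<in> game_states G \<Longrightarrow> value_iter G T (-1) (Suc j) s = value_iter G T (-1) j s"
    and "s \<in> game_states G" "j \<le> k"
  shows "value_iter G T (-1) k s = value_iter G T (-1) j s"
  using \<open>j \<le> k\<close> \<open>s \<in> game_states G\<close>
proof (induction k arbitrary: s rule: dec_induct)
  case base
  show ?case ..
next
  case (step k)
  have "maxmin G (value_iter G T (-1) k) s = maxmin G (value_iter G T (-1) j) s"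
    using maxmin_le_add[OF G step.prems, of "value_iter G T (-1) k" "value_iter G T (-1) j" 0]
      maxmin_le_add[OF G step.prems, of "value_iter G T (-1) j" "value_iter G T (-1) k" 0]
      step.IH by simp
  then have "value_iter G T (-1) (Suc k) s = value_iter G T (-1) (Suc j) s"
    unfolding value_iter_untruncated_step[OF G step.prems] by simp
  then show ?case using eq step.prems by simp
qed

lemma value_iter_untruncated_limit:
  assumes G: "concurrent_game G" and ne: "game_states G \<noteq> {}"
  obtains v where
    "\<And>s. s \<in> game_states G \<Longrightarrow> (\<lambda>k. value_iter G T (-1) k s) \<longlonglongrightarrow> v s"
    "\<And>s. s \<in> game_states G \<Longrightarrow> v s \<le> 1"
    "\<And>s. s \<in> game_states G \<Longrightarrow> v s = (if s \<in> T then 1 else maxmin G v s)"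
    "(\<lambda>k. sup_dist (game_states G) (value_iter G T (-1) k) v) \<longlonglongrightarrow> 0"
proof -
  let ?w = "value_iter G T (-1)" and ?S = "game_states G"
  note fin = concurrent_gameD(1)[OF G]
  define v where "v s = (SUP k. ?w k s)" for s
  have lim: "(\<lambda>k. ?w k s) \<longlonglongrightarrow> v s" if s: "s \<in> ?S" for s
    unfolding v_def
  proof (rule LIMSEQ_incseq_SUP)
    show "bdd_above (range (\<lambda>k. ?w k s))"
      using value_iter_untruncated_le_1[OF G s] by (intro bdd_aboveI[of _ 1]) auto
    show "incseq (\<lambda>k. ?w k s)"
      by (intro incseq_SucI value_iter_untruncated_mono[OF G s])
  qed
  \<comment> \<open>Pointwise convergence is uniform because the state set is finite.\<close>
  have unif: "\<forall>\<^sub>F k in sequentially. \<forall>s\<in>?S. \<bar>?w k s - v s\<bar> < e" if "e > 0" for e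
  proof (intro eventually_ball_finite[OF fin] ballI)
    fix s assume "s \<in> ?S"
    from tendstoD[OF lim[OF this] that] show "\<forall>\<^sub>F k in sequentially. \<bar>?w k s - v s\<bar> < e"
      by (simp add: dist_real_def)
  qed
  have fix_v: "v s = (if s \<in> T then 1 else maxmin G v s)" if s: "s \<in> ?S" for s
  proof -
    have mm: "(\<lambda>k. maxmin G (?w k) s) \<longlonglongrightarrow> maxmin G v s"
    proof (rule tendstoI)
      fix e :: real assume "e > 0"
      have "dist (maxmin G (?w k) s) (maxmin G v s) < e"
        if k: "\<forall>s\<in>?S. \<bar>?w k s - v s\<bar> < e / 2" for k
      proof -
        have le: "?w k s' \<le> v s' + e / 2" "v s' \<le> ?w k s' + e / 2" if "s' \<in> ?S" for s'
          using bspec[OF k that] by linarith+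
        have "maxmin G (?w k) s \<le> maxmin G v s + e / 2" "maxmin G v s \<le> maxmin G (?w k) s + e / 2"
          by (intro maxmin_le_add[OF G s] le; assumption)+
        with \<open>e > 0\<close> show ?thesis
          unfolding dist_real_def by linarith
      qed
      then show "\<forall>\<^sub>F k in sequentially. dist (maxmin G (?w k) s) (maxmin G v s) < e"
        using unif[of "e / 2"] \<open>e > 0\<close> by (auto elim: eventually_mono)
    qed
    \<comment> \<open>The shifted sequence also tends to \<open>v s\<close>, so uniqueness of limits
      gives the fixed-point equation.\<close>
    have "(\<lambda>k. ?w (Suc k) s) \<longlonglongrightarrow> (if s \<in> T then 1 else maxmin G v s)"
      unfolding value_iter_untruncated_step[OF G s] using mm by simp
    then show ?thesis
      using LIMSEQ_unique LIMSEQ_Suc[OF lim[OF s]] by blast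
  qed
  have "(\<lambda>k. sup_dist ?S (?w k) v) \<longlonglongrightarrow> 0"
  proof (rule tendstoI)
    fix e :: real assume "e > 0"
    from unif[OF this] show "\<forall>\<^sub>F k in sequentially. dist (sup_dist ?S (?w k) v) 0 < e"
      by (simp add: dist_real_def abs_of_nonneg[OF sup_dist_nonneg[OF fin ne]]
          sup_dist_less_iff[OF fin ne])
  qed
  moreover have "v s \<le> 1" if s: "s \<in> ?S" for s
    using value_iter_untruncated_le_1[OF G s] by (intro LIMSEQ_le_const2[OF lim[OF s]]) auto
  ultimately show thesis
    using that lim fix_v by blast
qed

section \<open>Choice of the tolerance\<close>

lemma value_iter_convergence:
  assumes G: "concurrent_game G" and ne: "game_states G \<noteq> {}"
    and lim: "(\<lambda>k. sup_dist (game_states G) (value_iter G T (-1) k) v) \<longlonglongrightarrow> 0"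
    and "\<epsilon> > 0"
  shows "\<exists>\<delta>>0. \<exists>K. \<forall>k>K. sup_dist (game_states G) (value_iter G T \<delta> k) v < \<epsilon>"
proof -
  let ?w = "value_iter G T (-1)" and ?d = "sup_dist (game_states G)"
  note fin = concurrent_gameD(1)[OF G]
  note nonneg = sup_dist_nonneg[OF fin ne]
  have close: "?d (?w k) v < \<epsilon>" if "\<forall>s\<in>game_states G. ?w k s = ?w k' s" "?d (?w k') v < \<epsilon>" for k k'
    using that unfolding sup_dist_less_iff[OF fin ne] by simp
  have "\<forall>\<^sub>F k in sequentially. ?d (?w k) v < \<epsilon>"
    using order_tendstoD(2)[OF lim \<open>\<epsilon> > 0\<close>] .
  then obtain N where N: "\<And>k. N \<le> k \<Longrightarrow> ?d (?w k) v < \<epsilon>"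
    unfolding eventually_sequentially by blast
  \<comment> \<open>The positive step sizes before \<open>N\<close>; the extra 1 keeps the set
    nonempty, so that \<open>Min P\<close> is meaningful even if there are none.\<close>
  define P where "P = insert 1 ((\<lambda>j. ?d (?w (Suc j)) (?w j)) ` {..<N} \<inter> {0<..})"
  have P: "finite P" "P \<noteq> {}" "\<And>x. x \<in> P \<Longrightarrow> 0 < x"
    unfolding P_def by auto
  define \<delta> where "\<delta> = Min P / 2"
  have "Min P > 0" using P by simp
  then have \<delta>: "\<delta> > 0" "\<delta> < Min P" by (simp_all add: \<delta>_def)
  have "?d (value_iter G T \<delta> (Suc k)) v < \<epsilon>" if "N \<le> k" for k
  proof -
    obtain j where j: "j \<le> k" "value_iter G T \<delta> (Suc k) = ?w (Suc j)"
      "j = k \<or> ?d (?w (Suc j)) (?w j) \<le> \<delta>"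
      using value_iter_eq_untruncated[OF fin ne, of \<delta> k T] \<delta> by auto
    have "?d (?w (Suc j)) v < \<epsilon>"
    proof (cases "N \<le> j")
      case True
      then show ?thesis by (intro N) simp
    next
      case False
      \<comment> \<open>Since \<open>j < N \<le> k\<close>, the case \<open>j = k\<close> is
        excluded: the loop stopped on a step smaller than every positive one before
        \<open>N\<close>, hence of size 0.\<close>
      then have le: "?d (?w (Suc j)) (?w j) < Min P"
        using j(3) \<delta> that by auto
      have "?d (?w (Suc j)) (?w j) = 0"
      proof (rule ccontr)
        assume "?d (?w (Suc j)) (?w j) \<noteq> 0"
        then have "?d (?w (Suc j)) (?w j) \<in> P"
          using False nonneg[of "?w (Suc j)" "?w j"] unfolding P_def by auto
        from Min_le[OF P(1) this] le show False by simp
      qed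
      then have eq: "?w (Suc j) s = ?w j s" if "s \<in> game_states G" for s
        using that unfolding sup_dist_eq_0_iff[OF fin ne] by blast
      have "?w (Suc j) s = ?w N s" if "s \<in> game_states G" for s
        using value_iter_untruncated_stationary[OF G eq that, of N] eq[OF that] False
        by simp
      then show ?thesis
        using close N by blast
    qed
    then show ?thesis by (simp only: j(2))
  qed
  \<comment> \<open>An index above \<open>N\<close> is the successor of one that is at least
    \<open>N\<close>.\<close>
  then have "\<forall>k>N. ?d (value_iter G T \<delta> k) v < \<epsilon>"
    by (metis Suc_le_D Suc_leI Suc_le_mono)
  then show ?thesis
    using \<delta>(1) by blast
qed

section \<open>The max-min on the target set\<close>

lemma payoff_modified_game_to_dest:
  assumes G: "concurrent_game G" and D: "finite D" "D \<noteq> {}"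
    and s: "s \<in> game_states (modified_game G E D)" "s \<in> target E"
    and \<tau>: "\<tau> \<in> mixed (adv (modified_game G E D) s)"
  shows "payoff (modified_game G E D) v s (return_pmf None) \<tau> = v None"
proof -
  let ?M = "modified_game G E D"
  note M = concurrent_game_modified_game[OF G D, of E]
  have fin: "finite (game_states ?M)" "finite (ctrl ?M s)" "finite (adv ?M s)"
    using concurrent_gameD[OF M] s by blast+
  have mem: "None \<in> game_states ?M" "None \<in> ctrl ?M s"
    using s by (auto simp: modified_game_def target_def)
  have tr: "trans_prob ?M s None a = return_pmf None" for a
    by (auto simp: modified_game_def split: option.splits)
  \<comment> \<open>Nested conditionals let the sums over \<open>u\<close> and \<open>s'\<close>
    collapse to the terms at \<open>None\<close>, leaving only the total mass of
    \<open>\<tau>\<close>.\<close>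
  have "payoff ?M v s (return_pmf None) \<tau> = (\<Sum>u\<in>ctrl ?M s. \<Sum>a\<in>adv ?M s. \<Sum>s'\<in>game_states ?M.
        if u = None then if s' = None then pmf \<tau> a * v None else 0 else 0)"
    unfolding payoff_def by (intro sum.cong refl) (auto simp: tr indicator_def)
  also have "\<dots> = (\<Sum>u\<in>ctrl ?M s. if u = None then (\<Sum>a\<in>adv ?M s. pmf \<tau> a * v None) else 0)"
    using fin mem by (intro sum.cong refl) (auto simp del: not_None_eq)
  also have "\<dots> = sum (pmf \<tau>) (adv ?M s) * v None"
    using fin mem by (simp add: sum_distrib_right)
  also have "\<dots> = v None"
    using \<tau> fin by (simp add: mixed_def sum_pmf_eq_1)
  finally show ?thesis .
qed

theorem theorem1:
  fixes G :: "('s, 'c, 'a) game" and E :: "'s set" and D :: "'a set"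
  assumes "concurrent_game G"
    and "E \<subseteq> game_states G"
    and "finite D" and "D \<noteq> {}"
  shows "\<exists>v_inf :: 's option \<Rightarrow> real.
    (\<forall>\<epsilon>>0. \<exists>\<delta>>0. \<exists>K. \<forall>k>K.
       sup_dist (game_states (modified_game G E D))
         (value_iter (modified_game G E D) (target E) \<delta> k) v_inf < \<epsilon>) \<and>
    (\<forall>s\<in>game_states (modified_game G E D). is_maxmin (modified_game G E D) v_inf s (v_inf s))"
proof -
  let ?M = "modified_game G E D"
  note M = concurrent_game_modified_game[OF assms(1,3,4), of E]
  have dest: "None \<in> game_states ?M" "None \<in> target E"
    by (simp_all add: modified_game_def target_def)
  then have ne: "game_states ?M \<noteq> {}" by blast
  obtain v where v: "\<And>s. s \<in> game_states ?M \<Longrightarrow> v s \<le> 1"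
    "\<And>s. s \<in> game_states ?M \<Longrightarrow> v s = (if s \<in> target E then 1 else maxmin ?M v s)"
    "(\<lambda>k. sup_dist (game_states ?M) (value_iter ?M (target E) (-1) k) v) \<longlonglongrightarrow> 0"
    by (rule value_iter_untruncated_limit[OF M ne, of "target E"]) blast
  have "v s = maxmin ?M v s" if s: "s \<in> game_states ?M" for s
  proof (cases "s \<in> target E")
    case True
    \<comment> \<open>The iteration sets the value 1 here instead of computing a max-min. Comparison
      with the zero vector caps the max-min at 1; the pure choice of \<open>d\<close> secures
      \<open>v None\<close>, which is 1.\<close>
    have "maxmin ?M v s \<le> maxmin ?M (\<lambda>_. 0) s + 1"
      using v(1) by (intro maxmin_le_add[OF M s]) simp
    moreover have "1 \<le> maxmin ?M v s"
    proof (rule maxmin_ge[OF M s])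
      show "return_pmf None \<in> mixed (ctrl ?M s)"
        using True by (auto simp: mixed_def modified_game_def target_def)
      fix \<tau> assume "\<tau> \<in> mixed (adv ?M s)"
      then show "1 \<le> payoff ?M v s (return_pmf None) \<tau>"
        using payoff_modified_game_to_dest[OF assms(1,3,4) s True] v(2)[OF dest(1)] dest(2) by simp
    qed
    ultimately show ?thesis
      using v(2)[OF s] True maxmin_0[OF M s] by simp
  next
    case False
    then show ?thesis using v(2)[OF s] by simp
  qed
  then have "\<forall>s\<in>game_states ?M. is_maxmin ?M v s (v s)"
    using is_maxmin_iff_maxmin[OF M] by blast
  then show ?thesis
    using value_iter_convergence[OF M ne v(3)] by blast
qed

end
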